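(* Let $X$ be a Banach space, let $E\subseteq X$ be nonempty and $q$-starshaped (with star-center $q\in E$), and let $A,B,S,T:E\to E$ be maps satisfying: (i) $A(E)\subseteq T(E)$ and $B(E)\subseteq S(E)$; (ii) for all $x,y\in E$, $$\begin{aligned}\|Ax-By\|^{2} \le{}& c_{1}\max\{[\delta(Sx,[q,Ax])]^{2},\,[\delta(Ty,[q,By])]^{2},\,\|Sx-Ty\|^{2}\}\\ &+c_{2}\max\{\delta(Sx,[q,Ax])\,\delta(Sx,[q,By]),\ \delta(Ty,[q,By])\,\delta(Ty,[q,Ax])\}\\ &+c_{3}\,\delta(Sx,[q,By])\,\delta(Ty,[q,Ax]),\end{aligned}$$ where $c_1,c_2,c_3\ge 0$ are constants with $c_1+2c_2=1$ and $c_1+c_3=1$; (iii) both pairs $(A,S)$ and $(B,T)$ are $C_q$-commuting on $E$, and $S$ and $T$ are $q$-affine. Assume further that $S$ and $T$ are weakly continuous on $E$ and that $S-A$ and $T-B$ are demiclosed at $0$. If either $S(E)$ or $T(E)$ is weakly compact, then $F(A)\cap F(B)\cap F(S)\cap F(T)\neq\emptyset$.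
   Context: For a selfmap $f$, $F(f)$ denotes its set of fixed points. For $x\in X$ and nonempty $C\subseteq X$, $\delta(x,C)=\inf\{\|x-z\|:z\in C\}$. For $q,x\in X$, $[q,x]=\{\lambda x+(1-\lambda)q:0\le\lambda\le 1\}$ is the line segment joining $q$ to $x$. A set $E\subseteq X$ is $q$-starshaped if $q\in E$ and $\lambda x+(1-\lambda)q\in E$ for all $x\in E$ and $0<\lambda<1$; $q$ is called the star-center. For $E$ $q$-starshaped, a map $f:E\to E$ is $q$-affine if $f(\lambda x+(1-\lambda)q)=\lambda f(x)+(1-\lambda)q$ for all $x\in E$ and $\lambda\in(0,1)$. A pair $(f,g)$ of selfmaps of a $q$-starshaped set $E$ is $C_q$-commuting if $fgx=gfx$ for all $x\in C_q(f,g)$, where $C_q(f,g)=\bigcup_{k\in[0,1]}\{x\in E: fx=kgx+(1-k)q\}$. A map $f:E\to E$ is weakly continuous if $fx_n\to fx$ weakly whenever $x_n\to x$ weakly ($x_n,x\in E$). A map $f:E\to X$ is demiclosed at $0$ if, whenever $\{x_n\}$ is a sequence in $E$ converging weakly to $x\in E$ and $fx_n\to 0$ strongly, then $fx=0$.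
   Formalization: The C_q-commuting condition is taken with the q-affine map first, i.e. for the pairs (S,A) and (T,B): commutation where Sx = kAx+(1-k)q and Tx = kBx+(1-k)q; with the literal order (A,S), (B,T) the claim is false. *)

theory Defs
  imports "HOL-Analysis.Analysis"
begin

definition weak_topology :: "'a::real_normed_vector topology" where
  "weak_topology =
     topology_generated_by {\<phi> -` U | \<phi> U. bounded_linear (\<phi> :: 'a \<Rightarrow> real) \<and> open U}"

lemma openin_weak_vimage:
  fixes \<phi> :: "'a::real_normed_vector \<Rightarrow> real"
  assumes "bounded_linear \<phi>" "open U"
  shows "openin weak_topology (\<phi> -` U)"
  unfolding weak_topology_def
  by (rule topology_generated_by_Basis) (use assms in blast)

lemma topspace_weak_topology [simp]:
  "topspace (weak_topology :: 'a::real_normed_vector topology) = UNIV"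
proof -
  have "openin weak_topology ((\<lambda>x::'a. 0::real) -` UNIV)"
    by (rule openin_weak_vimage) (auto simp: bounded_linear_zero)
  then show ?thesis
    using openin_subset[of weak_topology "UNIV :: 'a set"] by (simp add: top.extremum_unique)
qed

abbreviation weakly_converges :: "(nat \<Rightarrow> 'a::real_normed_vector) \<Rightarrow> 'a \<Rightarrow> bool" where
  "weakly_converges x l \<equiv> limitin weak_topology x l sequentially"

abbreviation weakly_compact :: "'a::real_normed_vector set \<Rightarrow> bool" where
  "weakly_compact K \<equiv> compactin weak_topology K"

lemma weakly_converges_iff:
  fixes x :: "nat \<Rightarrow> 'a::real_normed_vector"
  shows "weakly_converges x l \<longleftrightarrow>
    (\<forall>\<phi> :: 'a \<Rightarrow> real. bounded_linear \<phi> \<longrightarrow> (\<lambda>n. \<phi> (x n)) \<longlonglongrightarrow> \<phi> l)"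
proof
  assume L: "weakly_converges x l"
  show "\<forall>\<phi> :: 'a \<Rightarrow> real. bounded_linear \<phi> \<longrightarrow> (\<lambda>n. \<phi> (x n)) \<longlonglongrightarrow> \<phi> l"
  proof (intro allI impI)
    fix \<phi> :: "'a \<Rightarrow> real" assume \<phi>: "bounded_linear \<phi>"
    show "(\<lambda>n. \<phi> (x n)) \<longlonglongrightarrow> \<phi> l"
    proof (rule topological_tendstoI)
      fix U assume "open U" "\<phi> l \<in> U"
      then have "openin weak_topology (\<phi> -` U)" "l \<in> \<phi> -` U"
        using openin_weak_vimage[OF \<phi>] by auto
      with L have "\<forall>\<^sub>F n in sequentially. x n \<in> \<phi> -` U"
        unfolding limitin_def by blast
      then show "\<forall>\<^sub>F n in sequentially. \<phi> (x n) \<in> U"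
        by simp
    qed
  qed
next
  assume R: "\<forall>\<phi> :: 'a \<Rightarrow> real. bounded_linear \<phi> \<longrightarrow> (\<lambda>n. \<phi> (x n)) \<longlonglongrightarrow> \<phi> l"
  have "\<forall>\<^sub>F n in sequentially. x n \<in> W"
    if "openin weak_topology W" "l \<in> W" for W
  proof -
    have "generate_topology_on
        {\<phi> -` U | \<phi> U. bounded_linear (\<phi> :: 'a \<Rightarrow> real) \<and> open U} W"
      using that(1) unfolding weak_topology_def openin_topology_generated_by_iff .
    then show ?thesis using that(2)
    proof (induction rule: generate_topology_on.induct)
      case (Int a b)
      then show ?case by (auto simp: eventually_conj_iff)
    next
      case (UN K)
      then obtain k where "k \<in> K" "l \<in> k" by blast
      with UN.IH have "\<forall>\<^sub>F n in sequentially. x n \<in> k" by blast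
      then show ?case
        by (rule eventually_mono) (use \<open>k \<in> K\<close> in blast)
    next
      case (Basis s)
      then obtain \<phi> U where "s = \<phi> -` U" "bounded_linear (\<phi> :: 'a \<Rightarrow> real)" "open U"
        by blast
      with R Basis show ?case by (auto dest: topological_tendstoD)
    qed auto
  qed
  then show "weakly_converges x l"
    by (auto simp: limitin_def)
qed

definition q_starshaped :: "'a::real_vector \<Rightarrow> 'a set \<Rightarrow> bool" where
  "q_starshaped q E \<longleftrightarrow>
     q \<in> E \<and> (\<forall>x\<in>E. \<forall>l::real. 0 < l \<and> l < 1 \<longrightarrow> l *\<^sub>R x + (1 - l) *\<^sub>R q \<in> E)"

definition q_affine_on :: "'a::real_vector \<Rightarrow> 'a set \<Rightarrow> ('a \<Rightarrow> 'a) \<Rightarrow> bool" where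
  "q_affine_on q E f \<longleftrightarrow>
     (\<forall>x\<in>E. \<forall>l::real. 0 < l \<and> l < 1 \<longrightarrow>
        f (l *\<^sub>R x + (1 - l) *\<^sub>R q) = l *\<^sub>R f x + (1 - l) *\<^sub>R q)"

text \<open>
  The set \<open>C\<^sub>q(f, g)\<close> is not symmetric in the two maps: \<open>f\<close> is the map whose value has to lie on
  the segment joining \<open>q\<close> to the value of \<open>g\<close>.  In the theory of \<open>C\<^sub>q\<close>-commuting maps the
  \<open>q\<close>-affine map of the pair plays the role of \<open>f\<close>.
\<close>
definition Cq_set :: "'a::real_vector \<Rightarrow> 'a set \<Rightarrow> ('a \<Rightarrow> 'a) \<Rightarrow> ('a \<Rightarrow> 'a) \<Rightarrow> 'a set" where
  "Cq_set q E f g = (\<Union>k\<in>{0..1::real}. {x \<in> E. f x = k *\<^sub>R g x + (1 - k) *\<^sub>R q})"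

definition Cq_commuting :: "'a::real_vector \<Rightarrow> 'a set \<Rightarrow> ('a \<Rightarrow> 'a) \<Rightarrow> ('a \<Rightarrow> 'a) \<Rightarrow> bool" where
  "Cq_commuting q E f g \<longleftrightarrow> (\<forall>x\<in>Cq_set q E f g. f (g x) = g (f x))"

definition weakly_continuous_on ::
    "'a::real_normed_vector set \<Rightarrow> ('a \<Rightarrow> 'a) \<Rightarrow> bool" where
  "weakly_continuous_on E f \<longleftrightarrow>
     (\<forall>x l. (\<forall>n. x n \<in> E) \<and> l \<in> E \<and> weakly_converges x l \<longrightarrow>
        weakly_converges (\<lambda>n. f (x n)) (f l))"

definition demiclosed_at_0 ::
    "'a::real_normed_vector set \<Rightarrow> ('a \<Rightarrow> 'a) \<Rightarrow> bool" where
  "demiclosed_at_0 E f \<longleftrightarrow>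
     (\<forall>x l. (\<forall>n. x n \<in> E) \<and> l \<in> E \<and> weakly_converges x l \<and> (\<lambda>n. f (x n)) \<longlonglongrightarrow> 0 \<longrightarrow>
        f l = 0)"

definition fixed_points :: "'a set \<Rightarrow> ('a \<Rightarrow> 'a) \<Rightarrow> 'a set" where
  "fixed_points E f = {x \<in> E. f x = x}"

end

theory Submission
  imports Defs "HOL-Real_Asymp.Real_Asymp"
begin

text \<open>
  For \<open>0 < k < 1\<close> replace \<open>A\<close> and \<open>B\<close> by \<open>k A + (1 - k) q\<close> and \<open>k B + (1 - k) q\<close>. Their values lie on
  the segments \<open>[q, A x]\<close> and \<open>[q, B y]\<close>, so the inequality (ii) turns into a genuine contraction
  condition with factor \<open>k\<^sup>2\<close>; a Jungck iteration yields a point \<open>z\<^sub>k\<close> fixed by \<open>S\<close>, \<open>T\<close> and both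
  perturbed maps. As \<open>k\<close> tends to 1, the points \<open>z\<^sub>k = S z\<^sub>k\<close> stay in the weakly compact set \<open>S(E)\<close>,
  which is bounded and weakly sequentially compact (Eberlein-Smulian), so
  \<open>S z\<^sub>k - A z\<^sub>k = (1 - 1/k) (z\<^sub>k - q)\<close> tends to 0 and a weak limit of a subsequence is fixed by all
  four maps.
\<close>

section \<open>The Hahn-Banach theorem\<close>

text \<open>Homogeneity is required only as an inequality, which is what infima allow to be checked
  directly; equality for \<open>0 \<le> c\<close> follows by scaling back with
  \<open>inverse c\<close>.\<close>

definition sublinear :: "('a::real_vector \<Rightarrow> real) \<Rightarrow> bool" where
  "sublinear p \<longleftrightarrow>
     (\<forall>x y. p (x + y) \<le> p x + p y) \<and> (\<forall>c x. 0 \<le> c \<longrightarrow> p (c *\<^sub>R x) \<le> c * p x)"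

lemma sublinearI:
  assumes "\<And>x y. p (x + y) \<le> p x + p y" "\<And>c x. 0 \<le> c \<Longrightarrow> p (c *\<^sub>R x) \<le> c * p x"
  shows "sublinear p"
  using assms by (simp add: sublinear_def)

lemma sublinear_add: "sublinear p \<Longrightarrow> p (x + y) \<le> p x + p y"
  by (simp add: sublinear_def)

lemma sublinear_scaleR_le: "sublinear p \<Longrightarrow> 0 \<le> c \<Longrightarrow> p (c *\<^sub>R x) \<le> c * p x"
  by (simp add: sublinear_def)

lemma sublinear_0: "sublinear p \<Longrightarrow> p 0 = 0"
  using sublinear_add[of p 0 0] sublinear_scaleR_le[of p 0 0] by simp

lemma sublinear_scaleR:
  assumes p: "sublinear p" and "0 \<le> c"
  shows "p (c *\<^sub>R x) = c * p x"
proof (cases "c = 0")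
  case True
  with sublinear_0[OF p] show ?thesis by simp
next
  case False
  with \<open>0 \<le> c\<close> have "0 < c" by simp
  then have "p x \<le> inverse c * p (c *\<^sub>R x)"
    using sublinear_scaleR_le[OF p, of "inverse c" "c *\<^sub>R x"] by simp
  with \<open>0 < c\<close> have "c * p x \<le> p (c *\<^sub>R x)"
    by (simp add: field_simps)
  with sublinear_scaleR_le[OF p \<open>0 \<le> c\<close>, of x] show ?thesis by simp
qed

lemma sublinear_minus: "sublinear p \<Longrightarrow> - p (- x) \<le> p x"
  using sublinear_add[of p x "- x"] sublinear_0[of p] by simp

text \<open>A minimal sublinear functional coincides with each of its shifts, and \<open>r (- y) \<le> - p y\<close> then makes
  it linear: this proof of Hahn-Banach needs no partially defined functionals.\<close>

lemma sublinear_INF_shift: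
  fixes y :: "'a::real_vector"
  assumes p: "sublinear p"
  defines "r \<equiv> \<lambda>x. INF t\<in>{0..}. p (x + t *\<^sub>R y) - t * p y"
  shows "sublinear r" and "r x \<le> p x" and "r (- y) \<le> - p y"
proof -
  \<comment> \<open>Subadditivity at \<open>(x + t y) + (- x)\<close> bounds the family below
    independently of \<open>t\<close>, so the \<open>INF\<close> is a genuine infimum.\<close>
  have "- p (- x) \<le> p (x + t *\<^sub>R y) - t * p y" if "0 \<le> t" for t x
    using sublinear_add[OF p, of "x + t *\<^sub>R y" "- x"] sublinear_scaleR[OF p that, of y] by simp
  then have "bdd_below ((\<lambda>t. p (x + t *\<^sub>R y) - t * p y) ` {0..})" for x
    by (intro bdd_belowI[of _ "- p (- x)"]) auto
  then have lower: "r x \<le> p (x + t *\<^sub>R y) - t * p y" if "0 \<le> t" for t x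
    unfolding r_def using that by (intro cINF_lower) auto
  have greatest: "b \<le> r x" if "\<And>t. 0 \<le> t \<Longrightarrow> b \<le> p (x + t *\<^sub>R y) - t * p y" for b x
    unfolding r_def using that by (intro cINF_greatest) auto
  show "sublinear r"
  proof (rule sublinearI)
    fix x x'
    \<comment> \<open>Parameters \<open>t\<close> and \<open>s\<close> chosen separately for the two
      summands combine to the admissible parameter \<open>t + s\<close>.\<close>
    have "r (x + x') \<le> (p (x + t *\<^sub>R y) - t * p y) + (p (x' + s *\<^sub>R y) - s * p y)"
      if "0 \<le> t" "0 \<le> s" for s t
      using lower[of "t + s" "x + x'"] sublinear_add[OF p, of "x + t *\<^sub>R y" "x' + s *\<^sub>R y"] that
      by (simp add: algebra_simps)
    then have "r (x + x') - (p (x' + s *\<^sub>R y) - s * p y) \<le> r x" if "0 \<le> s" for s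
      using that by (intro greatest) (simp add: algebra_simps)
    then have "r (x + x') - r x \<le> r x'"
      by (intro greatest) (simp add: algebra_simps)
    then show "r (x + x') \<le> r x + r x'" by simp
  next
    fix c :: real and x assume "0 \<le> c"
    show "r (c *\<^sub>R x) \<le> c * r x"
    proof (cases "c = 0")
      case True
      then show ?thesis using lower[of 0 0] sublinear_0[OF p] by simp
    next
      case False
      with \<open>0 \<le> c\<close> have "0 < c" by simp
      have "r (c *\<^sub>R x) \<le> c * (p (x + t *\<^sub>R y) - t * p y)" if "0 \<le> t" for t
        using lower[of "c * t" "c *\<^sub>R x"] sublinear_scaleR[OF p \<open>0 \<le> c\<close>, of "x + t *\<^sub>R y"] that \<open>0 \<le> c\<close>
        by (simp add: algebra_simps)
      then have "r (c *\<^sub>R x) / c \<le> r x"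
        using \<open>0 < c\<close> by (intro greatest) (simp add: field_simps)
      then show ?thesis using \<open>0 < c\<close> by (simp add: field_simps)
    qed
  qed
  show "r x \<le> p x" using lower[of 0 x] by simp
  show "r (- y) \<le> - p y" using lower[of 1 "- y"] sublinear_0[OF p] by simp
qed

text \<open>Any two members of a chain lie above a common member, which is what makes the infimum
  subadditive; the bound \<open>p\<close> keeps it finite. These infima are the lower bounds that
  Zorn's lemma asks for.\<close>

lemma sublinear_INF_chain:
  assumes "C \<noteq> {}" and sub: "\<And>a. a \<in> C \<Longrightarrow> sublinear a" and le: "\<And>a. a \<in> C \<Longrightarrow> a \<le> p"
    and chain: "\<And>a b. a \<in> C \<Longrightarrow> b \<in> C \<Longrightarrow> a \<le> b \<or> b \<le> a"
  defines "u \<equiv> \<lambda>x. INF a\<in>C. a x"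
  shows "sublinear u" and "a \<in> C \<Longrightarrow> u \<le> a"
proof -
  have "- p (- x) \<le> a x" if "a \<in> C" for a x
    using sublinear_minus[OF sub[OF that], of x] le_funD[OF le[OF that], of "- x"] by simp
  then have "bdd_below ((\<lambda>a. a x) ` C)" for x
    by (intro bdd_belowI[of _ "- p (- x)"]) auto
  then have lower: "u x \<le> a x" if "a \<in> C" for a x
    unfolding u_def using that by (intro cINF_lower) auto
  have greatest: "b \<le> u x" if "\<And>a. a \<in> C \<Longrightarrow> b \<le> a x" for b x
    unfolding u_def using that \<open>C \<noteq> {}\<close> by (intro cINF_greatest) auto
  show "sublinear u"
  proof (rule sublinearI)
    fix x y
    have "u (x + y) \<le> a x + b y" if ab: "a \<in> C" "b \<in> C" for a b
    proof -
      obtain c where "c \<in> C" "c \<le> a" "c \<le> b"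
        using chain[OF ab] ab by blast
      then show ?thesis
        using lower[of c "x + y"] sublinear_add[OF sub, of c x y] le_funD[of c a x] le_funD[of c b y]
        by simp
    qed
    then have "u (x + y) - b y \<le> u x" if "b \<in> C" for b
      using that by (intro greatest) (simp add: algebra_simps)
    then have "u (x + y) - u x \<le> u y"
      by (intro greatest) (simp add: algebra_simps)
    then show "u (x + y) \<le> u x + u y" by simp
  next
    fix c :: real and x assume "0 \<le> c"
    have *: "u (c *\<^sub>R x) \<le> c * a x" if "a \<in> C" for a
      using lower[OF that, of "c *\<^sub>R x"] sublinear_scaleR[OF sub[OF that] \<open>0 \<le> c\<close>, of x] by simp
    show "u (c *\<^sub>R x) \<le> c * u x"
    proof (cases "c = 0")
      case True
      then show ?thesis using * \<open>C \<noteq> {}\<close> by auto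
    next
      case False
      with \<open>0 \<le> c\<close> have "0 < c" by simp
      then have "u (c *\<^sub>R x) / c \<le> u x"
        using * by (intro greatest) (simp add: field_simps)
      then show ?thesis using \<open>0 < c\<close> by (simp add: field_simps)
    qed
  qed
  show "u \<le> a" if "a \<in> C" using lower[OF that] by (simp add: le_fun_def)
qed

text \<open>Zorn's lemma for the reversed pointwise order; the empty chain is treated apart, as its
  \<open>INF\<close> carries no information.\<close>

lemma minimal_sublinear_exists:
  assumes p: "sublinear p"
  obtains f where "sublinear f" "f \<le> p" "\<And>g. sublinear g \<Longrightarrow> g \<le> f \<Longrightarrow> g = f"
proof -
  define A where "A = {q. sublinear q \<and> q \<le> p}"
  have "p \<in> A" using p by (simp add: A_def)
  have "\<exists>m\<in>A. \<forall>a\<in>A. a \<le> m \<longrightarrow> a = m"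
  proof (rule predicate_Zorn[where P = "\<lambda>a b. b \<le> a"])
    show "partial_order_on A (relation_of (\<lambda>a b. b \<le> a) A)"
      by (auto simp: partial_order_on_def preorder_on_def refl_on_def trans_def antisym_def
          relation_of_def)
  next
    fix C assume C: "C \<in> Chains (relation_of (\<lambda>a b. b \<le> a) A)"
    show "\<exists>u\<in>A. \<forall>a\<in>C. u \<le> a"
    proof (cases "C = {}")
      case True
      then show ?thesis using \<open>p \<in> A\<close> by auto
    next
      case False
      have CA: "a \<in> A" if "a \<in> C" for a
        using C that by (auto simp: Chains_def relation_of_def)
      have ch: "a \<le> b \<or> b \<le> a" if "a \<in> C" "b \<in> C" for a b
        using C that by (auto simp: Chains_def relation_of_def)
      define u where "u = (\<lambda>x. INF a\<in>C. a x)"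
      have u: "sublinear u" "\<And>a. a \<in> C \<Longrightarrow> u \<le> a"
        using sublinear_INF_chain[of C p, OF False _ _ ch] CA
        by (auto simp: A_def u_def)
      obtain a where "a \<in> C" using False by blast
      then have "u \<le> p" using u(2)[of a] CA[of a] by (auto simp: A_def)
      with u show ?thesis by (auto simp: A_def)
    qed
  qed
  then show ?thesis
    using that unfolding A_def by (metis (mono_tags, lifting) mem_Collect_eq order_trans)
qed

theorem Hahn_Banach_sublinear:
  fixes p :: "'a::real_vector \<Rightarrow> real"
  assumes p: "sublinear p"
  obtains f where "linear f" "\<And>x. f x \<le> p x" "f x0 = p x0"
proof -
  \<comment> \<open>Minimizing below the shift \<open>r\<close> along \<open>x0\<close>, rather than
    below \<open>p\<close>, builds in \<open>f (- x0) \<le> - p x0\<close>; together with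
    \<open>f \<le> p\<close> this yields equality at \<open>x0\<close>.\<close>
  define r where "r x = (INF t\<in>{0..}. p (x + t *\<^sub>R x0) - t * p x0)" for x
  note r = sublinear_INF_shift[OF p, where y = x0, folded r_def]
  obtain f where f: "sublinear f" "f \<le> r" and min: "\<And>g. sublinear g \<Longrightarrow> g \<le> f \<Longrightarrow> g = f"
    using minimal_sublinear_exists[OF r(1)] by blast
  have ge: "f x + f y \<le> f (x + y)" for x y
  proof -
    define g where "g x = (INF t\<in>{0..}. f (x + t *\<^sub>R y) - t * f y)" for x
    note g = sublinear_INF_shift[OF f(1), where y = y, folded g_def]
    \<comment> \<open>Minimality identifies \<open>f\<close> with its own shift along
      \<open>y\<close>, so \<open>f (- y) \<le> - f y\<close>, which turns subadditivity into
      additivity.\<close>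
    have "g = f" using g by (intro min) (auto simp: le_fun_def)
    then have "f (- y) \<le> - f y" using g(3) by simp
    moreover have "f x \<le> f (x + y) + f (- y)"
      using sublinear_add[OF f(1), of "x + y" "- y"] by simp
    ultimately show ?thesis by simp
  qed
  have add: "f (x + y) = f x + f y" for x y
    using ge[of x y] sublinear_add[OF f(1), of x y] by simp
  have minus: "f (- x) = - f x" for x
    using add[of x "- x"] sublinear_0[OF f(1)] by simp
  have "linear f"
  proof (rule linearI)
    fix c :: real and x
    show "f (c *\<^sub>R x) = c *\<^sub>R f x"
    proof (cases "0 \<le> c")
      case True
      then show ?thesis using sublinear_scaleR[OF f(1)] by simp
    next
      case False
      then have "f ((- c) *\<^sub>R x) = - c * f x" by (intro sublinear_scaleR[OF f(1)]) simp
      then show ?thesis using minus[of "c *\<^sub>R x"] by simp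
    qed
  qed (rule add)
  moreover have le: "f x \<le> p x" for x
    using le_funD[OF f(2), of x] r(2)[of x] by simp
  moreover have "f x0 = p x0"
    using le[of x0] le_funD[OF f(2), of "- x0"] r(3) minus[of x0] by simp
  ultimately show ?thesis using that by blast
qed

section \<open>Norming and separating functionals\<close>

lemma linear_le_norm_imp_abs_le:
  fixes f :: "'a::real_normed_vector \<Rightarrow> real"
  assumes "linear f" "\<And>x. f x \<le> norm x"
  shows "\<bar>f x\<bar> \<le> norm x"
  using assms(2)[of x] assms(2)[of "- x"] linear_neg[OF assms(1), of x] by simp

lemma bounded_linear_of_le_norm:
  fixes f :: "'a::real_normed_vector \<Rightarrow> real"
  assumes "linear f" "\<And>x. f x \<le> norm x"
  shows "bounded_linear f"
  using linear_le_norm_imp_abs_le[OF assms] assms(1)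
  by (intro bounded_linear_intro[of _ 1]) (auto simp: linear_add linear_scale)

lemma norming_functional_exists:
  fixes x0 :: "'a::real_normed_vector"
  obtains f :: "'a \<Rightarrow> real" where "bounded_linear f" "\<And>x. \<bar>f x\<bar> \<le> norm x" "f x0 = norm x0"
proof -
  have "sublinear (norm :: 'a \<Rightarrow> real)"
    by (auto intro: sublinearI norm_triangle_ineq)
  then obtain f :: "'a \<Rightarrow> real" where "linear f" "\<And>x. f x \<le> norm x" "f x0 = norm x0"
    using Hahn_Banach_sublinear[of norm x0] by blast
  then show ?thesis
    using that bounded_linear_of_le_norm linear_le_norm_imp_abs_le by metis
qed

text \<open>A functional dominated by the distance to \<open>Y\<close> is forced to vanish on
  \<open>Y\<close>, so this is the function to which Hahn-Banach is applied for separation.\<close>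

lemma sublinear_infdist:
  fixes Y :: "'a::real_normed_vector set"
  assumes Y: "subspace Y"
  shows "sublinear (\<lambda>x. infdist x Y)"
proof -
  have ne: "Y \<noteq> {}" using subspace_0[OF Y] by blast
  have le: "infdist x Y \<le> norm (x - y)" if "y \<in> Y" for x y
    using infdist_le[OF that, of x] by (simp add: dist_norm)
  have greatest: "b \<le> infdist x Y" if "\<And>y. y \<in> Y \<Longrightarrow> b \<le> norm (x - y)" for b x
    unfolding infdist_notempty[OF ne] dist_norm using that ne by (intro cINF_greatest) auto
  show ?thesis
  proof (rule sublinearI)
    fix x x'
    have "infdist (x + x') Y \<le> norm (x - y) + norm (x' - y')" if "y \<in> Y" "y' \<in> Y" for y y'
    proof -
      have "infdist (x + x') Y \<le> norm ((x + x') - (y + y'))"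
        using that Y by (intro le subspace_add)
      also have "\<dots> \<le> norm (x - y) + norm (x' - y')"
        using norm_triangle_ineq[of "x - y" "x' - y'"] by (simp add: algebra_simps)
      finally show ?thesis .
    qed
    then have "infdist (x + x') Y - norm (x' - y') \<le> infdist x Y" if "y' \<in> Y" for y'
      using that by (intro greatest) (simp add: algebra_simps)
    then have "infdist (x + x') Y - infdist x Y \<le> infdist x' Y"
      by (intro greatest) (simp add: algebra_simps)
    then show "infdist (x + x') Y \<le> infdist x Y + infdist x' Y" by simp
  next
    fix c :: real and x assume "0 \<le> c"
    show "infdist (c *\<^sub>R x) Y \<le> c * infdist x Y"
    proof (cases "c = 0")
      case True
      then show ?thesis using subspace_0[OF Y] by simp
    next
      case False
      with \<open>0 \<le> c\<close> have "0 < c" by simp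
      have "infdist (c *\<^sub>R x) Y \<le> c * norm (x - y)" if "y \<in> Y" for y
        using le[of "c *\<^sub>R y" "c *\<^sub>R x"] subspace_scale[OF Y that, of c] \<open>0 \<le> c\<close>
        by (simp flip: scaleR_diff_right)
      then have "infdist (c *\<^sub>R x) Y / c \<le> infdist x Y"
        using \<open>0 < c\<close> by (intro greatest) (simp add: field_simps)
      then show ?thesis using \<open>0 < c\<close> by (simp add: field_simps)
    qed
  qed
qed

text \<open>The distance to \<open>Y\<close> vanishes at \<open>y\<close> and \<open>- y\<close> for
  \<open>y \<in> Y\<close>, and is positive at \<open>x0\<close> because \<open>Y\<close> is closed;
  Hahn-Banach attains that positive value.\<close>

lemma separating_functional_exists:
  fixes Y :: "'a::real_normed_vector set"
  assumes Y: "subspace Y" "closed Y" and "x0 \<notin> Y"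
  obtains f :: "'a \<Rightarrow> real" where "bounded_linear f" "\<And>y. y \<in> Y \<Longrightarrow> f y = 0" "f x0 \<noteq> 0"
proof -
  obtain f where f: "linear f" "\<And>x. f x \<le> infdist x Y" "f x0 = infdist x0 Y"
    using Hahn_Banach_sublinear[OF sublinear_infdist[OF Y(1)]] by blast
  have "f x \<le> norm x" for x
    using f(2)[of x] infdist_le[OF subspace_0[OF Y(1)], of x] by simp
  then have "bounded_linear f"
    by (intro bounded_linear_of_le_norm f(1))
  moreover have "f y = 0" if "y \<in> Y" for y
    using f(2)[of y] f(2)[of "- y"] that subspace_neg[OF Y(1) that] linear_neg[OF f(1), of y]
    by simp
  moreover have "f x0 \<noteq> 0"
    using f(3) \<open>x0 \<notin> Y\<close> Y in_closed_iff_infdist_zero[of Y x0] subspace_0 by auto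
  ultimately show ?thesis using that by blast
qed

section \<open>Weakly compact sets\<close>

lemma continuous_map_weak_topology:
  fixes \<phi> :: "'a::real_normed_vector \<Rightarrow> real"
  assumes "bounded_linear \<phi>"
  shows "continuous_map weak_topology euclidean \<phi>"
  using openin_weak_vimage[OF assms] by (simp add: continuous_map_def vimage_def)

text \<open>A norming functional of \<open>x - y\<close> takes different values at \<open>x\<close>
  and \<open>y\<close>, and disjoint open sets of reals pull back.\<close>

lemma Hausdorff_weak_topology:
  "Hausdorff_space (weak_topology :: 'a::real_normed_vector topology)"
proof -
  have "\<exists>U V. openin weak_topology U \<and> openin weak_topology V \<and> x \<in> U \<and> y \<in> V \<and> disjnt U V"
    if "x \<noteq> y" for x y :: 'a
  proof -
    obtain f :: "'a \<Rightarrow> real" where f: "bounded_linear f" "f (x - y) = norm (x - y)"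
      using norming_functional_exists by blast
    have ne: "f x \<noteq> f y"
      using f that bounded_linear.linear[OF f(1)] linear_diff[of f x y] by auto
    then obtain U V where "open U" "open V" "f x \<in> U" "f y \<in> V" "U \<inter> V = {}"
      using hausdorff[OF ne] by blast
    then have "openin weak_topology (f -` U)" "openin weak_topology (f -` V)"
      "disjnt (f -` U) (f -` V)" "x \<in> f -` U" "y \<in> f -` V"
      using openin_weak_vimage[OF f(1)] by (auto simp: disjnt_def)
    then show ?thesis by blast
  qed
  then show ?thesis by (simp add: Hausdorff_space_def)
qed

lemma weakly_converges_unique:
  assumes "weakly_converges x l" "weakly_converges x m"
  shows "l = m"
  using limitin_Hausdorff_unique[OF assms _ Hausdorff_weak_topology] by simp

lemma tendsto_imp_weakly_converges:
  "x \<longlonglongrightarrow> l \<Longrightarrow> weakly_converges x l"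
  by (auto simp: weakly_converges_iff intro: bounded_linear.tendsto)

text \<open>Compact sets are closed in the Hausdorff weak topology, and norm limits are weak limits.
  This supplies the closed image needed by the fixed point iteration.\<close>

lemma weakly_compact_imp_closed:
  assumes "weakly_compact K"
  shows "closed K"
  unfolding closed_sequential_limits
proof (intro allI impI)
  fix x l assume x: "(\<forall>n. x n \<in> K) \<and> x \<longlonglongrightarrow> l"
  have "closedin weak_topology K"
    using compactin_imp_closedin[OF Hausdorff_weak_topology assms] .
  then show "l \<in> K"
    using limitin_closedin[of weak_topology x l sequentially K] x
    by (simp add: tendsto_imp_weakly_converges)
qed

text \<open>The set where a separating functional is nonzero is a weak neighbourhood of the outside
  point that misses \<open>Y\<close>.\<close>

lemma closedin_weak_topology_subspace:
  fixes Y :: "'a::real_normed_vector set"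
  assumes "subspace Y" "closed Y"
  shows "closedin weak_topology Y"
proof -
  have "\<exists>T. openin weak_topology T \<and> x \<in> T \<and> T \<subseteq> - Y" if "x \<in> - Y" for x
  proof -
    obtain f :: "'a \<Rightarrow> real" where f: "bounded_linear f" "\<And>y. y \<in> Y \<Longrightarrow> f y = 0" "f x \<noteq> 0"
      using separating_functional_exists[OF assms] \<open>x \<in> - Y\<close> by blast
    have "openin weak_topology (f -` (- {0}))"
      by (intro openin_weak_vimage f) auto
    then show ?thesis using f by blast
  qed
  then have "openin weak_topology (- Y)"
    by (subst openin_subopen) blast
  then show ?thesis by (simp add: closedin_def Compl_eq_Diff_UNIV)
qed

section \<open>Weak sequential compactness of weakly compact sets\<close>

lemma subspace_closure_rational:
  fixes D :: "'a::real_normed_vector set"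
  assumes "D \<noteq> {}" and add: "\<And>x y. x \<in> D \<Longrightarrow> y \<in> D \<Longrightarrow> x + y \<in> D"
    and scale: "\<And>c x. c \<in> \<rat> \<Longrightarrow> x \<in> D \<Longrightarrow> c *\<^sub>R x \<in> D"
  shows "subspace (closure D)"
  unfolding subspace_def
proof (intro conjI ballI allI)
  obtain x where "x \<in> D" using \<open>D \<noteq> {}\<close> by blast
  then have "0 \<in> D" using scale[of 0 x] by simp
  then show "0 \<in> closure D" using closure_subset by blast
next
  fix x y assume "x \<in> closure D" "y \<in> closure D"
  then obtain u v where "\<And>n. u n \<in> D" "u \<longlonglongrightarrow> x" "\<And>n. v n \<in> D" "v \<longlonglongrightarrow> y"
    unfolding closure_sequential by blast
  then have "\<And>n. u n + v n \<in> D" "(\<lambda>n. u n + v n) \<longlonglongrightarrow> x + y"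
    using add by (auto intro: tendsto_add)
  then show "x + y \<in> closure D"
    unfolding closure_sequential by (intro exI[of _ "\<lambda>n. u n + v n"]) simp
next
  fix c :: real and x assume x: "x \<in> closure D"
  have rat: "r *\<^sub>R x \<in> closure D" if "r \<in> \<rat>" for r
  proof -
    obtain u where "\<And>n. u n \<in> D" "u \<longlonglongrightarrow> x"
      using x unfolding closure_sequential by blast
    then have "\<And>n. r *\<^sub>R u n \<in> D" "(\<lambda>n. r *\<^sub>R u n) \<longlonglongrightarrow> r *\<^sub>R x"
      using scale[OF that] by (auto intro: tendsto_intros)
    then show ?thesis
      unfolding closure_sequential by (intro exI[of _ "\<lambda>n. r *\<^sub>R u n"]) simp
  qed
  have "\<exists>r\<in>\<rat>. dist r c < e" if "e > 0" for e
    using Rats_dense_in_real[of "c - e" c] that by (force simp: dist_real_def)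
  then have "c \<in> closure \<rat>" by (simp add: closure_approachable)
  then obtain r where "\<And>n. r n \<in> \<rat>" "r \<longlonglongrightarrow> c" unfolding closure_sequential by blast
  then have "\<And>n. r n *\<^sub>R x \<in> closure D" "(\<lambda>n. r n *\<^sub>R x) \<longlonglongrightarrow> c *\<^sub>R x"
    using rat by (auto intro: tendsto_intros)
  then show "c *\<^sub>R x \<in> closure D"
    by (rule closed_sequentially[OF closed_closure])
qed

text \<open>Elements of the countable type \<open>(rat \<times> nat) list\<close> encode finite
  rational combinations of the sequence, so \<open>from_nat\<close> enumerates all of them.
  Appending lists adds the combinations, and no normal form is required.\<close>

lemma separable_subspace_exists:
  fixes x :: "nat \<Rightarrow> 'a::real_normed_vector"
  obtains d :: "nat \<Rightarrow> 'a" where "subspace (closure (range d))" "range x \<subseteq> closure (range d)"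
proof -
  define h :: "(rat \<times> nat) list \<Rightarrow> 'a"
    where "h L = (\<Sum>(r, i)\<leftarrow>L. of_rat r *\<^sub>R x i)" for L
  have h_append: "h L + h M = h (L @ M)" for L M by (simp add: h_def)
  have h_scale: "of_rat r *\<^sub>R h L = h (map (\<lambda>(s, i). (r * s, i)) L)" for r L
    by (induction L) (auto simp: h_def scaleR_add_right of_rat_mult)
  define d :: "nat \<Rightarrow> 'a" where "d = h \<circ> from_nat"
  have range_d: "range d = range h"
    unfolding d_def image_comp[symmetric] by (simp add: surj_from_nat)
  have "subspace (closure (range h))"
  proof (rule subspace_closure_rational)
    show "x + y \<in> range h" if "x \<in> range h" "y \<in> range h" for x y
      using that h_append by auto
    show "c *\<^sub>R x \<in> range h" if "c \<in> \<rat>" "x \<in> range h" for c x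
      using that h_scale by (auto elim!: Rats_cases)
  qed simp
  moreover have "x i = h [(1, i)]" for i by (simp add: h_def)
  then have "range x \<subseteq> range h" by blast
  ultimately show ?thesis
    using that[of d] range_d closure_subset[of "range h"] by (metis subset_trans)
qed

text \<open>Norming functionals of the dense points suffice. If all vanish at
  \<open>y \<noteq> 0\<close>, pick \<open>d i\<close> within \<open>norm y / 2\<close> of
  \<open>y\<close>: then \<open>norm (d i) = \<phi> i (d i - y)\<close> is below
  \<open>norm y / 2\<close>, against the triangle inequality.\<close>

lemma countable_separating_functionals_exist:
  fixes d :: "nat \<Rightarrow> 'a::real_normed_vector"
  obtains \<phi> :: "nat \<Rightarrow> 'a \<Rightarrow> real" where "\<And>i. bounded_linear (\<phi> i)"
    "\<And>y. y \<in> closure (range d) \<Longrightarrow> (\<And>i. \<phi> i y = 0) \<Longrightarrow> y = 0"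
proof -
  have "\<exists>f :: 'a \<Rightarrow> real. bounded_linear f \<and> (\<forall>x. \<bar>f x\<bar> \<le> norm x) \<and> f (d i) = norm (d i)" for i
    using norming_functional_exists[of "d i"] by metis
  then obtain \<phi> :: "nat \<Rightarrow> 'a \<Rightarrow> real" where \<phi>: "\<And>i. bounded_linear (\<phi> i)"
    "\<And>i x. \<bar>\<phi> i x\<bar> \<le> norm x" "\<And>i. \<phi> i (d i) = norm (d i)"
    by metis
  have "y = 0" if y: "y \<in> closure (range d)" and 0: "\<And>i. \<phi> i y = 0" for y
  proof (rule ccontr)
    assume "y \<noteq> 0"
    then obtain i where i: "dist (d i) y < norm y / 2"
      using y unfolding closure_approachable by (force dest: spec[of _ "norm y / 2"])
    have "norm (d i) = \<phi> i (d i - y)"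
      using \<phi>(3)[of i] 0[of i] bounded_linear.linear[OF \<phi>(1)] by (simp add: linear_diff)
    also have "\<dots> \<le> dist (d i) y"
      using \<phi>(2)[of i "d i - y"] by (simp add: dist_norm)
    finally show False
      using i norm_triangle_ineq2[of y "d i"] by (simp add: dist_norm norm_minus_commute)
  qed
  with \<phi>(1) show ?thesis using that by blast
qed

text \<open>A countable separating family embeds the part of \<open>K\<close> in a separable closed subspace into the
  metrizable space \<open>nat \<Rightarrow> real\<close>; by compactness the embedding is a homeomorphism onto its image.\<close>

theorem weakly_compact_imp_weakly_seq_compact:
  fixes x :: "nat \<Rightarrow> 'a::real_normed_vector"
  assumes K: "weakly_compact K" and x: "\<And>n. x n \<in> K"
  obtains l r where "l \<in> K" "strict_mono r" "weakly_converges (x \<circ> r) l"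
proof -
  obtain d :: "nat \<Rightarrow> 'a"
    where d: "subspace (closure (range d))" "range x \<subseteq> closure (range d)"
    by (rule separable_subspace_exists[of x])
  obtain \<phi> :: "nat \<Rightarrow> 'a \<Rightarrow> real" where \<phi>: "\<And>i. bounded_linear (\<phi> i)"
    "\<And>y. y \<in> closure (range d) \<Longrightarrow> (\<And>i. \<phi> i y = 0) \<Longrightarrow> y = 0"
    by (rule countable_separating_functionals_exist[of d]) blast
  \<comment> \<open>On this part of \<open>K\<close> the countable family separates points, and it
    stays weakly compact because the closed subspace is weakly closed.\<close>
  define K' where "K' = closure (range d) \<inter> K"
  have K': "weakly_compact K'"
    unfolding K'_def by (intro closed_Int_compactin closedin_weak_topology_subspace d K) simp
  define F where "F x = (\<lambda>i. \<phi> i x)" for x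
  have contF: "continuous_map weak_topology euclidean F"
    unfolding euclidean_product_topology[symmetric] continuous_map_componentwise_UNIV F_def
    using continuous_map_weak_topology[OF \<phi>(1)] by blast
  have injF: "inj_on F K'"
  proof (rule inj_onI)
    fix y z assume "y \<in> K'" "z \<in> K'" and eq: "F y = F z"
    then have "y - z \<in> closure (range d)"
      using d(1) by (auto simp: K'_def intro: subspace_diff)
    moreover have "\<phi> i (y - z) = 0" for i
      using fun_cong[OF eq, of i] bounded_linear.linear[OF \<phi>(1)] by (simp add: F_def linear_diff)
    ultimately show "y = z" using \<phi>(2)[of "y - z"] by simp
  qed
  have "continuous_map (subtopology euclidean (F ` K')) (subtopology weak_topology K')
          (inv_into K' F)"
  proof (rule continuous_inverse_map[where f = F])
    show "compact_space (subtopology weak_topology K')"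
      using K' by (simp add: compactin_subspace)
    show "continuous_map (subtopology weak_topology K') euclidean F"
      using contF by (rule continuous_map_from_subtopology)
  qed (use injF in \<open>auto\<close>)
  then have continv: "continuous_map (subtopology euclidean (F ` K')) weak_topology (inv_into K' F)"
    using continuous_map_into_fulltopology by blast
  have "compact (F ` K')"
    using image_compactin[OF K' contF] by simp
  moreover have xK': "x n \<in> K'" for n using x d(2) by (auto simp: K'_def)
  ultimately obtain l r where l: "l \<in> K'" and r: "strict_mono r" "((\<lambda>n. F (x n)) \<circ> r) \<longlonglongrightarrow> F l"
    using compact_imp_seq_compact[of "F ` K'"] unfolding seq_compact_def
    by (metis (mono_tags, lifting) imageE imageI)
  \<comment> \<open>The subsequence was found in the metrizable image; the continuous inverse of
    \<open>F\<close> carries its limit back to the weak topology.\<close>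
  have "limitin (subtopology euclidean (F ` K')) ((\<lambda>n. F (x n)) \<circ> r) (F l) sequentially"
    using r(2) l xK' by (simp add: limitin_subtopology)
  from continuous_map_limit[OF continv this] have "weakly_converges (x \<circ> r) l"
    using injF l xK' by (simp add: o_def)
  with l r(1) show ?thesis using that by (auto simp: K'_def)
qed

text \<open>Uniform boundedness, applied in the dual space: the sets \<open>F m\<close> are closed
  and cover the dual, which is complete, so by Baire one of them contains a ball.\<close>

theorem weakly_converges_imp_bounded:
  fixes x :: "nat \<Rightarrow> 'a::real_normed_vector"
  assumes x: "weakly_converges x l"
  shows "bounded (range x)"
proof -
  define F :: "nat \<Rightarrow> ('a \<Rightarrow>\<^sub>L real) set"
    where "F m = {\<phi>. \<forall>n. \<bar>blinfun_apply \<phi> (x n)\<bar> \<le> real m}" for m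
  have "closed (F m)" for m
    unfolding F_def
    by (intro closed_Collect_all closed_Collect_le continuous_intros)
  moreover have UN: "\<Union>(range F) = UNIV"
  proof -
    have "\<exists>m. \<phi> \<in> F m" for \<phi> :: "'a \<Rightarrow>\<^sub>L real"
    proof -
      have "(\<lambda>n. blinfun_apply \<phi> (x n)) \<longlonglongrightarrow> blinfun_apply \<phi> l"
        using x unfolding weakly_converges_iff by (simp add: blinfun.bounded_linear_right)
      then have "Bseq (\<lambda>n. blinfun_apply \<phi> (x n))"
        by (intro convergent_imp_Bseq convergentI)
      then obtain C where "\<forall>n. norm (blinfun_apply \<phi> (x n)) \<le> C" by (rule BseqE)
      then have C: "\<bar>blinfun_apply \<phi> (x n)\<bar> \<le> C" for n by simp
      obtain m where "C \<le> real m" using real_arch_simple by blast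
      with C have "\<phi> \<in> F m" unfolding F_def using order_trans by blast
      then show ?thesis ..
    qed
    then show ?thesis by blast
  qed
  ultimately obtain m where "interior (F m) \<noteq> {}"
    using Baire_category_alt[of euclidean "range F"] completely_metrizable_space_euclidean
    by fastforce
  then obtain \<phi>0 e where e: "e > 0" "cball \<phi>0 e \<subseteq> F m"
    by (metis all_not_in_conv mem_interior_cball)
  have "norm (x n) \<le> 2 * real m / e" for n
  proof -
    \<comment> \<open>Both the centre \<open>\<phi>0\<close> and the point
      \<open>\<phi>0 + e \<psi>\<close> of the ball are bounded by \<open>m\<close> at
      \<open>x n\<close>; their difference there is \<open>e * norm (x n)\<close>.\<close>
    obtain f :: "'a \<Rightarrow> real" where f: "bounded_linear f" "\<And>y. \<bar>f y\<bar> \<le> norm y" "f (x n) = norm (x n)"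
      using norming_functional_exists by blast
    define \<psi> where "\<psi> = Blinfun f"
    have \<psi>: "blinfun_apply \<psi> = f"
      unfolding \<psi>_def by (rule bounded_linear_Blinfun_apply[OF f(1)])
    have "norm \<psi> \<le> 1"
      by (intro norm_blinfun_bound) (simp_all add: \<psi> f(2))
    then have "\<phi>0 + e *\<^sub>R \<psi> \<in> F m" "\<phi>0 \<in> F m"
      using e by (auto simp: subset_iff dist_norm)
    then have "\<bar>blinfun_apply \<phi>0 (x n) + e * norm (x n)\<bar> \<le> real m" "\<bar>blinfun_apply \<phi>0 (x n)\<bar> \<le> real m"
      unfolding F_def by (auto simp: blinfun.add_left blinfun.scaleR_left \<psi> f(3) dest: spec[of _ n])
    then have "e * norm (x n) \<le> 2 * real m" by linarith
    then show ?thesis using e(1) by (simp add: field_simps)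
  qed
  then show ?thesis by (auto simp: bounded_iff)
qed

section \<open>Common fixed points of contractive maps\<close>

lemma Cauchy_geometric:
  fixes y :: "nat \<Rightarrow> 'a::metric_space"
  assumes k: "0 \<le> k" "k < 1"
    and step: "\<And>n. dist (y (Suc n)) (y (Suc (Suc n))) \<le> k * dist (y n) (y (Suc n))"
  shows "Cauchy y"
proof -
  define a where "a = dist (y 0) (y 1)"
  have d: "dist (y n) (y (Suc n)) \<le> k ^ n * a" for n
  proof (induction n)
    case (Suc n)
    have "dist (y (Suc n)) (y (Suc (Suc n))) \<le> k * (k ^ n * a)"
      using order_trans[OF step mult_left_mono[OF Suc.IH k(1)]] .
    then show ?case by simp
  qed (simp add: a_def)
  \<comment> \<open>With \<open>1 - k\<close> on the left, the geometric series telescopes without a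
    division.\<close>
  have tele: "(1 - k) * dist (y n) (y (n + j)) \<le> (k ^ n - k ^ (n + j)) * a" for n j
  proof (induction j)
    case (Suc j)
    have "(1 - k) * dist (y n) (y (n + Suc j))
          \<le> (1 - k) * (dist (y n) (y (n + j)) + k ^ (n + j) * a)"
      using dist_triangle[of "y n" "y (n + Suc j)" "y (n + j)"] d[of "n + j"] k
      by (intro mult_left_mono) auto
    also have "\<dots> \<le> (k ^ n - k ^ (n + Suc j)) * a"
      using Suc.IH by (simp add: algebra_simps)
    finally show ?case .
  qed simp
  have bound: "dist (y n) (y (n + j)) \<le> k ^ n * (a / (1 - k))" for n j
  proof -
    have "(k ^ n - k ^ (n + j)) * a \<le> k ^ n * a"
      using k by (intro mult_right_mono) (auto simp: a_def)
    with tele[of n j] k show ?thesis by (simp add: field_simps)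
  qed
  have "(\<lambda>n. k ^ n * (a / (1 - k))) \<longlonglongrightarrow> 0"
    using k by (intro tendsto_mult_left_zero LIMSEQ_realpow_zero) auto
  show ?thesis
  proof (rule metric_CauchyI)
    fix e :: real assume "0 < e"
    then obtain N where N: "k ^ N * (a / (1 - k)) < e / 2"
      using order_tendstoD(2)[OF \<open>(\<lambda>n. k ^ n * (a / (1 - k))) \<longlonglongrightarrow> 0\<close>, of "e / 2"]
      by (auto simp: eventually_sequentially)
    have "dist (y m) (y n) < e" if "m \<ge> N" "n \<ge> N" for m n
    proof -
      have "dist (y N) (y m) < e / 2" "dist (y N) (y n) < e / 2"
        using le_less_trans[OF bound N, of "m - N"] le_less_trans[OF bound N, of "n - N"] that
        by simp_all
      then show ?thesis using dist_triangle3[of "y m" "y n" "y N"] by linarith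
    qed
    then show "\<exists>M. \<forall>m\<ge>M. \<forall>n\<ge>M. dist (y m) (y n) < e" by blast
  qed
qed

text \<open>The right side of (ii) with each distance to a segment replaced by the distance to one
  point of it: \<open>a\<close> and \<open>b\<close> stand for values of the perturbed maps. In this
  form it makes sense in any metric space.\<close>

definition contractive_bound ::
    "real \<Rightarrow> real \<Rightarrow> real \<Rightarrow> 'a::metric_space \<Rightarrow> 'a \<Rightarrow> 'a \<Rightarrow> 'a \<Rightarrow> real" where
  "contractive_bound c1 c2 c3 a b s t =
     c1 * max ((dist s a)\<^sup>2) (max ((dist t b)\<^sup>2) ((dist s t)\<^sup>2))
     + c2 * max (dist s a * dist s b) (dist t b * dist t a)
     + c3 * (dist s b * dist t a)"

text \<open>This symmetry lets a single one-step estimate serve both parities of the iteration, and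
  later exchanges the pairs \<open>(A, S)\<close> and \<open>(B, T)\<close>.\<close>

lemma contractive_bound_swap:
  "contractive_bound c1 c2 c3 a b s t = contractive_bound c1 c2 c3 b a t s"
  by (simp add: contractive_bound_def dist_commute max.commute max.left_commute mult.commute)

text \<open>With \<open>t = a\<close> the \<open>c3\<close>-term vanishes, and \<open>c1 + 2 * c2 = 1\<close> is what remains.\<close>

lemma contractive_bound_imp_dist_le:
  fixes a b s :: "'a::metric_space"
  assumes c: "0 \<le> c1" "0 \<le> c2" "c1 + 2 * c2 = 1" and k: "0 \<le> k" "k < 1"
    and le: "(dist a b)\<^sup>2 \<le> k\<^sup>2 * contractive_bound c1 c2 c3 a b s a"
  shows "dist a b \<le> k * dist s a"
proof -
  define u v where "u = dist s a" and "v = dist a b"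
  \<comment> \<open>\<open>M\<close> bounds both distances at once, and
    \<open>dist s b \<le> u + v \<le> 2 * M\<close> is the source of the factor 2 at
    \<open>c2\<close>.\<close>
  define M where "M = max u v"
  have uv: "0 \<le> u" "0 \<le> v" "u \<le> M" "v \<le> M" "0 \<le> M"
    by (auto simp: u_def v_def M_def le_max_iff_disj)
  have "dist s b \<le> 2 * M"
    using dist_triangle[of s b a] uv unfolding u_def v_def by linarith
  then have "u * dist s b \<le> M * (2 * M)"
    using uv by (intro mult_mono) auto
  also have "\<dots> = 2 * M\<^sup>2" by (simp add: power2_eq_square)
  finally have "u * dist s b \<le> 2 * M\<^sup>2" .
  moreover have "u\<^sup>2 \<le> M\<^sup>2" "v\<^sup>2 \<le> M\<^sup>2" using uv by (auto intro: power_mono)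
  ultimately have "contractive_bound c1 c2 c3 a b s a \<le> c1 * M\<^sup>2 + c2 * (2 * M\<^sup>2)"
    unfolding contractive_bound_def using c uv
    by (simp flip: u_def v_def)
      (intro add_mono mult_left_mono, auto simp flip: power2_eq_square)
  also have "\<dots> = (c1 + 2 * c2) * M\<^sup>2" by (simp add: algebra_simps)
  finally have "v\<^sup>2 \<le> k\<^sup>2 * M\<^sup>2"
    using order_trans[OF le mult_left_mono[of _ "M\<^sup>2" "k\<^sup>2"]] c(3) by (simp add: v_def)
  then have "v \<le> k * M"
    using k uv by (metis mult_nonneg_nonneg power2_le_imp_le power_mult_distrib)
  \<comment> \<open>Otherwise \<open>M = v\<close>, and \<open>v \<le> k * v\<close> is impossible
    for positive \<open>v\<close>.\<close>
  moreover have "v \<le> u"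
  proof (rule ccontr)
    assume "\<not> v \<le> u"
    then have "M = v" "0 < v" using uv by (auto simp: M_def)
    with \<open>v \<le> k * M\<close> k show False by simp
  qed
  then have "M = u" by (simp add: M_def)
  ultimately show ?thesis by (simp add: u_def v_def)
qed

lemma eq_of_dist_sq_le:
  assumes "(dist a b)\<^sup>2 \<le> h * (dist a b)\<^sup>2" "h < 1"
  shows "a = b"
proof (rule ccontr)
  assume "a \<noteq> b"
  then have "0 < (dist a b)\<^sup>2" by simp
  with assms show False by (metis mult.commute mult_less_cancel_left2 not_less)
qed

text \<open>Jungck iteration: \<open>A x\<^bsub>2n\<^esub> = T x\<^bsub>2n+1\<^esub>\<close> and \<open>B x\<^bsub>2n+1\<^esub> = S x\<^bsub>2n+2\<^esub>\<close>.\<close>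

theorem common_fixed_point_of_contractive:
  fixes A B S T :: "'a::complete_space \<Rightarrow> 'a"
  assumes "E \<noteq> {}" and AE: "A ` E \<subseteq> E"
    and AT: "A ` E \<subseteq> T ` E" and BS: "B ` E \<subseteq> S ` E" and clo: "closed (S ` E)"
    and c: "0 \<le> c1" "0 \<le> c2" "c1 + 2 * c2 = 1" "c1 + c3 = 1"
    and k: "0 \<le> k" "k < 1"
    and contr: "\<And>x y. x \<in> E \<Longrightarrow> y \<in> E \<Longrightarrow>
      (dist (A x) (B y))\<^sup>2 \<le> k\<^sup>2 * contractive_bound c1 c2 c3 (A x) (B y) (S x) (T y)"
    and comS: "\<And>x. x \<in> E \<Longrightarrow> S x = A x \<Longrightarrow> S (A x) = A (S x)"
    and comT: "\<And>x. x \<in> E \<Longrightarrow> T x = B x \<Longrightarrow> T (B x) = B (T x)"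
  obtains z where "z \<in> E" "A z = z" "B z = z" "S z = z" "T z = z"
proof -
  have k2: "k\<^sup>2 < 1" using k by (simp add: power_less_one_iff)
  define f where "f x = inv_into E T (A x)" for x
  define g where "g x = inv_into E S (B x)" for x
  have f: "f x \<in> E \<and> T (f x) = A x" if "x \<in> E" for x
    unfolding f_def using AT that by (blast intro: inv_into_into f_inv_into_f)
  have g: "g x \<in> E \<and> S (g x) = B x" if "x \<in> E" for x
    unfolding g_def using BS that by (blast intro: inv_into_into f_inv_into_f)
  obtain x0 where "x0 \<in> E" using \<open>E \<noteq> {}\<close> by blast
  define x where "x n = rec_nat x0 (\<lambda>n u. if even n then f u else g u) n" for n :: nat
  have xE: "x n \<in> E" for n
    by (induction n) (auto simp: x_def \<open>x0 \<in> E\<close> f g)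
  define y where "y n = (if even n then A (x n) else B (x n))" for n
  have Tx: "T (x (Suc n)) = y n" if "even n" for n
    using that f[OF xE] by (simp add: x_def y_def)
  have Sx: "S (x (Suc n)) = y n" if "odd n" for n
    using that g[OF xE] by (simp add: x_def y_def)
  have "dist (y (Suc n)) (y (Suc (Suc n))) \<le> k * dist (y n) (y (Suc n))" for n
  proof (rule contractive_bound_imp_dist_le[OF c(1-3) k])
    show "(dist (y (Suc n)) (y (Suc (Suc n))))\<^sup>2
      \<le> k\<^sup>2 * contractive_bound c1 c2 c3 (y (Suc n)) (y (Suc (Suc n))) (y n) (y (Suc n))"
    proof (cases "even n")
      \<comment> \<open>Here the later term is the \<open>A\<close>-value, so the contraction
        condition has to be read with the two pairs exchanged.\<close>
      case True
      then show ?thesis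
        using contr[OF xE xE, of "Suc (Suc n)" "Suc n"] Tx[of n] Sx[of "Suc n"]
        by (simp add: y_def dist_commute contractive_bound_swap[of _ _ _ "A _" "B _"])
    next
      case False
      then show ?thesis
        using contr[OF xE xE, of "Suc n" "Suc (Suc n)"] Sx[of n] Tx[of "Suc n"]
        by (simp add: y_def)
    qed
  qed
  then have "Cauchy y" using k by (intro Cauchy_geometric)
  then obtain z where z: "y \<longlonglongrightarrow> z" using Cauchy_convergent convergent_def by blast
  have odd_lim: "(\<lambda>n. y (Suc (2 * n))) \<longlonglongrightarrow> z"
    by (rule LIMSEQ_subseq_LIMSEQ[OF z, of "\<lambda>n. Suc (2 * n)", unfolded o_def])
      (simp add: strict_mono_def)
  have even_lim: "(\<lambda>n. y (2 * n)) \<longlonglongrightarrow> z"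
    by (rule LIMSEQ_subseq_LIMSEQ[OF z, of "\<lambda>n. 2 * n", unfolded o_def])
      (simp add: strict_mono_def)
  \<comment> \<open>The odd terms are values of \<open>B\<close>, hence lie in the closed set
    \<open>S(E)\<close>. So \<open>z\<close> first gets a preimage \<open>u\<close> under
    \<open>S\<close>; its preimage \<open>v\<close> under \<open>T\<close> comes from
    \<open>A u = z\<close>.\<close>
  have "y (Suc (2 * n)) \<in> S ` E" for n
    using BS xE by (auto simp: y_def)
  then have "z \<in> S ` E" using closed_sequentially[OF clo _ odd_lim] by blast
  then obtain u where u: "u \<in> E" "S u = z" by blast
  have "(dist (A u) z)\<^sup>2 \<le> k\<^sup>2 * contractive_bound c1 c2 c3 (A u) z z z"
  proof (rule tendsto_le[OF sequentially_bot])
    show "(\<lambda>n. (dist (A u) (y (Suc (2 * n))))\<^sup>2) \<longlonglongrightarrow> (dist (A u) z)\<^sup>2"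
      by (intro tendsto_intros odd_lim)
    show "(\<lambda>n. k\<^sup>2 * contractive_bound c1 c2 c3 (A u) (y (Suc (2 * n))) z (y (2 * n)))
        \<longlonglongrightarrow> k\<^sup>2 * contractive_bound c1 c2 c3 (A u) z z z"
      unfolding contractive_bound_def by (intro tendsto_intros odd_lim even_lim)
    show "\<forall>\<^sub>F n in sequentially. (dist (A u) (y (Suc (2 * n))))\<^sup>2
        \<le> k\<^sup>2 * contractive_bound c1 c2 c3 (A u) (y (Suc (2 * n))) z (y (2 * n))"
    proof (rule always_eventually, rule allI)
      fix n
      have "y (Suc (2 * n)) = B (x (Suc (2 * n)))" by (simp add: y_def)
      then show "(dist (A u) (y (Suc (2 * n))))\<^sup>2
        \<le> k\<^sup>2 * contractive_bound c1 c2 c3 (A u) (y (Suc (2 * n))) z (y (2 * n))"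
        using contr[OF u(1) xE, of "Suc (2 * n)"] u(2) Tx[of "2 * n"] by simp
    qed
  qed
  then have "(dist (A u) z)\<^sup>2 \<le> (k\<^sup>2 * c1) * (dist (A u) z)\<^sup>2"
    by (simp add: contractive_bound_def dist_commute mult.assoc)
  moreover have k2c1: "k\<^sup>2 * c1 < 1"
    using mult_left_le[of c1 "k\<^sup>2"] c k2 by simp
  ultimately have Au: "A u = z" by (rule eq_of_dist_sq_le)
  then obtain v where v: "v \<in> E" "T v = z" using AT u(1) by (metis image_iff image_subset_iff)
  have "(dist z (B v))\<^sup>2 \<le> (k\<^sup>2 * c1) * (dist z (B v))\<^sup>2"
    using contr[OF u(1) v(1)] by (simp add: Au u v contractive_bound_def mult.assoc)
  then have Bv: "B v = z" using eq_of_dist_sq_le[OF _ k2c1] by metis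
  have zE: "z \<in> E" using Au u(1) AE by blast
  have SA: "S z = A z" using comS[OF u(1)] u(2) Au by simp
  have TB: "T z = B z" using comT[OF v(1)] v(2) Bv by simp
  \<comment> \<open>At \<open>(z, v)\<close> only \<open>\<parallel>S z - T v\<parallel>\<close> and
    the \<open>c3\<close>-product survive, both giving the squared distance, so
    \<open>c1 + c3 = 1\<close> leaves the factor \<open>k\<^sup>2\<close>.\<close>
  have "(dist (A z) z)\<^sup>2 \<le> k\<^sup>2 * (dist (A z) z)\<^sup>2"
    using contr[OF zE v(1)] c(4)
    by (simp add: Bv v SA contractive_bound_def dist_commute power2_eq_square flip: distrib_right)
  then have Az: "A z = z" using eq_of_dist_sq_le[OF _ k2] by metis
  have "(dist z (B z))\<^sup>2 \<le> k\<^sup>2 * (dist z (B z))\<^sup>2"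
    using contr[OF u(1) zE] c(4)
    by (simp add: Au u TB contractive_bound_def dist_commute power2_eq_square flip: distrib_right)
  then have "B z = z" using eq_of_dist_sq_le[OF _ k2] by metis
  with that zE Az SA TB show ?thesis by metis
qed

section \<open>Common fixed points under weak compactness\<close>

lemma q_starshaped_mem:
  "q_starshaped q E \<Longrightarrow> x \<in> E \<Longrightarrow> 0 < l \<Longrightarrow> l < 1 \<Longrightarrow> l *\<^sub>R x + (1 - l) *\<^sub>R q \<in> E"
  by (simp add: q_starshaped_def)

lemma q_affine_onD:
  "q_affine_on q E f \<Longrightarrow> x \<in> E \<Longrightarrow> 0 < l \<Longrightarrow> l < 1 \<Longrightarrow>
    f (l *\<^sub>R x + (1 - l) *\<^sub>R q) = l *\<^sub>R f x + (1 - l) *\<^sub>R q"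
  by (simp add: q_affine_on_def)

text \<open>If \<open>A x = T y\<close>, a \<open>q\<close>-affine \<open>T\<close> attains the
  perturbed value of \<open>A\<close> at \<open>k y + (1 - k) q\<close>, a point of the starshaped
  set.\<close>

lemma contract_image_subset:
  assumes star: "q_starshaped q E" and aff: "q_affine_on q E T" and AT: "A ` E \<subseteq> T ` E"
    and k: "0 < k" "k < 1"
  shows "(\<lambda>x. k *\<^sub>R A x + (1 - k) *\<^sub>R q) ` E \<subseteq> T ` E"
proof (rule image_subsetI)
  fix x assume "x \<in> E"
  then obtain y where y: "y \<in> E" "A x = T y" using AT by blast
  then have "k *\<^sub>R A x + (1 - k) *\<^sub>R q = T (k *\<^sub>R y + (1 - k) *\<^sub>R q)"
    using q_affine_onD[OF aff y(1) k] by simp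
  then show "k *\<^sub>R A x + (1 - k) *\<^sub>R q \<in> T ` E"
    using q_starshaped_mem[OF star y(1) k] by blast
qed

text \<open>A coincidence point of \<open>S\<close> with the perturbed map belongs to
  \<open>Cq_set\<close> for this very \<open>k\<close>, so \<open>S\<close> and \<open>A\<close>
  commute there; affinity of \<open>S\<close> at \<open>A x\<close> extends this to the perturbed
  map.\<close>

lemma Cq_commuting_contract:
  assumes com: "Cq_commuting q E S A" and aff: "q_affine_on q E S"
    and AE: "A ` E \<subseteq> E" and k: "0 < k" "k < 1" and x: "x \<in> E"
    and eq: "S x = k *\<^sub>R A x + (1 - k) *\<^sub>R q"
  shows "S (k *\<^sub>R A x + (1 - k) *\<^sub>R q) = k *\<^sub>R A (S x) + (1 - k) *\<^sub>R q"
proof -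
  have "x \<in> Cq_set q E S A"
    unfolding Cq_set_def using x eq k by (auto intro!: bexI[of _ k])
  then have "S (A x) = A (S x)" using com by (simp add: Cq_commuting_def)
  then show ?thesis using q_affine_onD[OF aff _ k] AE x by (simp add: image_subset_iff)
qed

lemma infdist_closed_segment_le:
  fixes q a s :: "'a::real_normed_vector"
  assumes "0 \<le> k" "k \<le> 1"
  shows "infdist s (closed_segment q a) \<le> dist s (k *\<^sub>R a + (1 - k) *\<^sub>R q)"
  using assms by (intro infdist_le) (auto simp: in_segment add.commute intro!: exI[of _ k])

lemma dist_contract:
  fixes q :: "'a::real_normed_vector"
  assumes "0 \<le> k"
  shows "dist (k *\<^sub>R a + (1 - k) *\<^sub>R q) (k *\<^sub>R b + (1 - k) *\<^sub>R q) = k * norm (a - b)"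
  using assms by (simp add: dist_norm flip: scaleR_diff_right)

text \<open>The perturbed points lie on the segments, and maxima and products of nonnegative terms
  are monotone. The left side is free of \<open>k\<close>, so one inequality (ii) serves all
  perturbed maps.\<close>

lemma segment_bound_le_contractive_bound:
  fixes q :: "'a::real_normed_vector"
  assumes c: "0 \<le> c1" "0 \<le> c2" "0 \<le> c3" and k: "0 \<le> k" "k \<le> 1"
  shows "c1 * Max {(infdist s (closed_segment q a))\<^sup>2, (infdist t (closed_segment q b))\<^sup>2,
                   (norm (s - t))\<^sup>2}
    + c2 * max (infdist s (closed_segment q a) * infdist s (closed_segment q b))
               (infdist t (closed_segment q b) * infdist t (closed_segment q a))
    + c3 * (infdist s (closed_segment q b) * infdist t (closed_segment q a))
    \<le> contractive_bound c1 c2 c3 (k *\<^sub>R a + (1 - k) *\<^sub>R q) (k *\<^sub>R b + (1 - k) *\<^sub>R q) s t"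
proof -
  have Max3: "Max {x, y, z} = max x (max y z)" for x y z :: real by simp
  show ?thesis
    unfolding contractive_bound_def Max3 dist_norm[of s t, symmetric]
    by (intro add_mono mult_left_mono max.mono mult_mono power_mono order_refl
        infdist_closed_segment_le infdist_nonneg zero_le_dist mult_nonneg_nonneg c k)
qed

text \<open>The hypotheses are symmetric under exchanging \<open>(A, S)\<close> and \<open>(B, T)\<close>, so this also covers the
  case that \<open>T(E)\<close> is weakly compact.\<close>

lemma common_fixed_point_if_weakly_compact:
  fixes E :: "'a::banach set"
  assumes star: "q_starshaped q E"
    and AE: "A ` E \<subseteq> E" and BE: "B ` E \<subseteq> E" and SE: "S ` E \<subseteq> E"
    and AT: "A ` E \<subseteq> T ` E" and BS: "B ` E \<subseteq> S ` E"
    and c: "0 \<le> c1" "0 \<le> c2" "c1 + 2 * c2 = 1" "c1 + c3 = 1"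
    and contr: "\<And>k x y. 0 < k \<Longrightarrow> k < 1 \<Longrightarrow> x \<in> E \<Longrightarrow> y \<in> E \<Longrightarrow>
      (norm (A x - B y))\<^sup>2 \<le> contractive_bound c1 c2 c3
         (k *\<^sub>R A x + (1 - k) *\<^sub>R q) (k *\<^sub>R B y + (1 - k) *\<^sub>R q) (S x) (T y)"
    and comS: "Cq_commuting q E S A" and comT: "Cq_commuting q E T B"
    and affS: "q_affine_on q E S" and affT: "q_affine_on q E T"
    and wcS: "weakly_continuous_on E S" and wcT: "weakly_continuous_on E T"
    and demiS: "demiclosed_at_0 E (\<lambda>x. S x - A x)" and demiT: "demiclosed_at_0 E (\<lambda>x. T x - B x)"
    and K: "weakly_compact (S ` E)"
  shows "\<exists>z\<in>E. A z = z \<and> B z = z \<and> S z = z \<and> T z = z"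
proof -
  have approx: "\<exists>z\<in>E. k *\<^sub>R A z + (1 - k) *\<^sub>R q = z \<and> k *\<^sub>R B z + (1 - k) *\<^sub>R q = z
      \<and> S z = z \<and> T z = z" if k: "0 < k" "k < 1" for k
  proof (rule common_fixed_point_of_contractive[where E = E and S = S and T = T
        and ?c1.0 = c1 and ?c2.0 = c2 and ?c3.0 = c3 and k = k
        and A = "\<lambda>x. k *\<^sub>R A x + (1 - k) *\<^sub>R q" and B = "\<lambda>x. k *\<^sub>R B x + (1 - k) *\<^sub>R q"])
    show "E \<noteq> {}" using star by (auto simp: q_starshaped_def)
    show "(\<lambda>x. k *\<^sub>R A x + (1 - k) *\<^sub>R q) ` E \<subseteq> E"
      using AE q_starshaped_mem[OF star _ k] by blast
    show "(\<lambda>x. k *\<^sub>R A x + (1 - k) *\<^sub>R q) ` E \<subseteq> T ` E"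
      by (rule contract_image_subset[OF star affT AT k])
    show "(\<lambda>x. k *\<^sub>R B x + (1 - k) *\<^sub>R q) ` E \<subseteq> S ` E"
      by (rule contract_image_subset[OF star affS BS k])
    show "closed (S ` E)" by (rule weakly_compact_imp_closed[OF K])
    show "0 \<le> k" "k < 1" using k by auto
    show "(dist (k *\<^sub>R A x + (1 - k) *\<^sub>R q) (k *\<^sub>R B y + (1 - k) *\<^sub>R q))\<^sup>2
      \<le> k\<^sup>2 * contractive_bound c1 c2 c3
          (k *\<^sub>R A x + (1 - k) *\<^sub>R q) (k *\<^sub>R B y + (1 - k) *\<^sub>R q) (S x) (T y)"
      if "x \<in> E" "y \<in> E" for x y
      \<comment> \<open>The common summand \<open>(1 - k) q\<close> cancels on the left and
        \<open>k\<^sup>2\<close> comes out, while the bound already refers to the perturbed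
        values.\<close>
      unfolding dist_contract[OF less_imp_le[OF k(1)]] power_mult_distrib
      by (intro mult_left_mono contr k that) simp
    show "S (k *\<^sub>R A x + (1 - k) *\<^sub>R q) = k *\<^sub>R A (S x) + (1 - k) *\<^sub>R q"
      if "x \<in> E" "S x = k *\<^sub>R A x + (1 - k) *\<^sub>R q" for x
      by (rule Cq_commuting_contract[OF comS affS AE k that])
    show "T (k *\<^sub>R B x + (1 - k) *\<^sub>R q) = k *\<^sub>R B (T x) + (1 - k) *\<^sub>R q"
      if "x \<in> E" "T x = k *\<^sub>R B x + (1 - k) *\<^sub>R q" for x
      by (rule Cq_commuting_contract[OF comT affT BE k that])
  qed (use c in auto)
  \<comment> \<open>The offset 2 gives \<open>k 0 = 1 / 2\<close>, so that every \<open>k n\<close>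
    lies strictly between 0 and 1.\<close>
  define k :: "nat \<Rightarrow> real" where "k n = 1 - 1 / (real n + 2)" for n
  have k: "0 < k n" "k n < 1" for n by (auto simp: k_def field_simps)
  have k_lim: "k \<longlonglongrightarrow> 1" unfolding k_def by real_asymp
  obtain z where z: "\<And>n. z n \<in> E" "\<And>n. k n *\<^sub>R A (z n) + (1 - k n) *\<^sub>R q = z n"
    "\<And>n. k n *\<^sub>R B (z n) + (1 - k n) *\<^sub>R q = z n" "\<And>n. S (z n) = z n" "\<And>n. T (z n) = z n"
    using approx[OF k] by metis
  have zS: "z n \<in> S ` E" for n using imageI[OF z(1), of S n] z(4)[of n] by simp
  obtain l r where l: "l \<in> S ` E" and r: "strict_mono r" and lim: "weakly_converges (z \<circ> r) l"
    by (rule weakly_compact_imp_weakly_seq_compact[OF K zS])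
  have lE: "l \<in> E" using l SE by blast
  obtain C where C: "\<And>n. norm (z (r n)) \<le> C"
    using weakly_converges_imp_bounded[OF lim] by (auto simp: bounded_iff)
  \<comment> \<open>A generic \<open>G\<close> covers both \<open>A\<close> and \<open>B\<close>:
    solving its equation leaves a factor tending to 0 times \<open>z (r n) - q\<close>, which is
    bounded.\<close>
  have vanish: "(\<lambda>n. z (r n) - G (z (r n))) \<longlonglongrightarrow> 0"
    if G: "\<And>n. k n *\<^sub>R G (z n) + (1 - k n) *\<^sub>R q = z n" for G :: "'a \<Rightarrow> 'a"
  proof -
    have "z n - G (z n) = (1 - 1 / k n) *\<^sub>R (z n - q)" for n
    proof -
      have "k n *\<^sub>R (z n - G (z n)) = k n *\<^sub>R ((1 - 1 / k n) *\<^sub>R (z n - q))"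
        using arg_cong[OF G[of n], of "\<lambda>u. k n *\<^sub>R z n + (1 - k n) *\<^sub>R q - u"] k(1)[of n]
        by (simp add: algebra_simps)
      then show ?thesis using k(1)[of n] by (simp del: scaleR_scaleR)
    qed
    moreover have "(\<lambda>n. (1 - 1 / k (r n)) *\<^sub>R (z (r n) - q)) \<longlonglongrightarrow> 0"
    proof (rule Lim_null_comparison)
      show "\<forall>\<^sub>F n in sequentially. norm ((1 - 1 / k (r n)) *\<^sub>R (z (r n) - q))
          \<le> \<bar>1 - 1 / k (r n)\<bar> * (C + norm q)"
      proof (rule always_eventually, rule allI)
        fix n
        have "norm (z (r n) - q) \<le> C + norm q"
          using C[of n] norm_triangle_ineq4[of "z (r n)" q] by linarith
        then show "norm ((1 - 1 / k (r n)) *\<^sub>R (z (r n) - q))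
            \<le> \<bar>1 - 1 / k (r n)\<bar> * (C + norm q)"
          unfolding norm_scaleR by (intro mult_left_mono) simp_all
      qed
      have "(\<lambda>n. k (r n)) \<longlonglongrightarrow> 1"
        using LIMSEQ_subseq_LIMSEQ[OF k_lim r] by (simp add: o_def)
      then have "(\<lambda>n. \<bar>1 - 1 / k (r n)\<bar> * (C + norm q)) \<longlonglongrightarrow> \<bar>1 - 1 / 1\<bar> * (C + norm q)"
        by (intro tendsto_intros) auto
      then show "(\<lambda>n. \<bar>1 - 1 / k (r n)\<bar> * (C + norm q)) \<longlonglongrightarrow> 0" by simp
    qed
    ultimately show ?thesis by simp
  qed
  have seq: "(\<forall>n. z (r n) \<in> E) \<and> l \<in> E \<and> weakly_converges (\<lambda>n. z (r n)) l"
    using z(1) lE lim unfolding o_def by blast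
  \<comment> \<open>Weak continuity makes \<open>G l\<close> a second weak limit of the sequence of
    fixed points, and weak limits are unique.\<close>
  have fixed: "G l = l" if "weakly_continuous_on E G" "\<And>n. G (z n) = z n" for G
  proof -
    have "weakly_converges (\<lambda>n. G (z (r n))) (G l)"
      by (rule mp[OF spec[OF spec[OF that(1)[unfolded weakly_continuous_on_def]]] seq])
    then have "weakly_converges (\<lambda>n. z (r n)) (G l)" unfolding that(2) .
    then show ?thesis using weakly_converges_unique seq by blast
  qed
  have Sl: "S l = l" and Tl: "T l = l" using fixed[OF wcS z(4)] fixed[OF wcT z(5)] .
  \<comment> \<open>Since \<open>S\<close> fixes each \<open>z n\<close>, the vanishing differences
    are values of \<open>S - A\<close>, to which demiclosedness applies.\<close>
  have "S l - A l = 0"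
    using spec[OF spec[OF demiS[unfolded demiclosed_at_0_def]], of "\<lambda>n. z (r n)" l]
      vanish[OF z(2)] seq unfolding z(4) by blast
  moreover have "T l - B l = 0"
    using spec[OF spec[OF demiT[unfolded demiclosed_at_0_def]], of "\<lambda>n. z (r n)" l]
      vanish[OF z(3)] seq unfolding z(5) by blast
  ultimately show ?thesis using Sl Tl lE by (intro bexI[of _ l]) simp_all
qed

theorem theorem2p3:
  fixes E :: "'a::banach set" and q :: 'a
    and A B S T :: "'a \<Rightarrow> 'a"
    and c1 c2 c3 :: real
  assumes "E \<noteq> {}" and "q_starshaped q E"
    and "A ` E \<subseteq> E" and "B ` E \<subseteq> E" and "S ` E \<subseteq> E" and "T ` E \<subseteq> E"
    and "A ` E \<subseteq> T ` E" and "B ` E \<subseteq> S ` E"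
    and "c1 \<ge> 0" and "c2 \<ge> 0" and "c3 \<ge> 0"
    and "c1 + 2 * c2 = 1" and "c1 + c3 = 1"
    and "\<forall>x\<in>E. \<forall>y\<in>E.
      (norm (A x - B y))\<^sup>2 \<le>
        c1 * Max {(infdist (S x) (closed_segment q (A x)))\<^sup>2,
                  (infdist (T y) (closed_segment q (B y)))\<^sup>2,
                  (norm (S x - T y))\<^sup>2}
        + c2 * max (infdist (S x) (closed_segment q (A x)) * infdist (S x) (closed_segment q (B y)))
                   (infdist (T y) (closed_segment q (B y)) * infdist (T y) (closed_segment q (A x)))
        + c3 * (infdist (S x) (closed_segment q (B y)) * infdist (T y) (closed_segment q (A x)))"
    and "Cq_commuting q E S A" and "Cq_commuting q E T B"
    and "q_affine_on q E S" and "q_affine_on q E T"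
    and "weakly_continuous_on E S" and "weakly_continuous_on E T"
    and "demiclosed_at_0 E (\<lambda>x. S x - A x)" and "demiclosed_at_0 E (\<lambda>x. T x - B x)"
    and "weakly_compact (S ` E) \<or> weakly_compact (T ` E)"
  shows "fixed_points E A \<inter> fixed_points E B \<inter> fixed_points E S \<inter> fixed_points E T \<noteq> {}"
proof -
  have ex: "\<exists>z\<in>E. A z = z \<and> B z = z \<and> S z = z \<and> T z = z"
  proof -
    have contr: "(norm (A x - B y))\<^sup>2 \<le> contractive_bound c1 c2 c3
         (k *\<^sub>R A x + (1 - k) *\<^sub>R q) (k *\<^sub>R B y + (1 - k) *\<^sub>R q) (S x) (T y)"
      if k: "0 < k" "k < 1" and xy: "x \<in> E" "y \<in> E" for k x y
      by (rule order_trans[OF assms(14)[rule_format, OF xy] segment_bound_le_contractive_bound])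
        (use assms(9-11) k in auto)
    \<comment> \<open>The same condition with the two pairs exchanged, as needed when
      \<open>T(E)\<close> is the weakly compact image.\<close>
    have contr': "(norm (B y - A x))\<^sup>2 \<le> contractive_bound c1 c2 c3
         (k *\<^sub>R B y + (1 - k) *\<^sub>R q) (k *\<^sub>R A x + (1 - k) *\<^sub>R q) (T y) (S x)"
      if "0 < k" "k < 1" "y \<in> E" "x \<in> E" for k x y
      using contr[OF that(1,2,4,3)] by (subst contractive_bound_swap) (simp add: norm_minus_commute)
    from \<open>weakly_compact (S ` E) \<or> weakly_compact (T ` E)\<close> show ?thesis
    proof
      assume "weakly_compact (S ` E)"
      from common_fixed_point_if_weakly_compact[OF assms(2-5,7-10,12,13) contr assms(15-22) this]
      show ?thesis .
    next
      assume "weakly_compact (T ` E)"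
      from common_fixed_point_if_weakly_compact[OF assms(2,4,3,6,8,7,9,10,12,13) contr'
          assms(16,15,18,17,20,19,22,21) this]
      show ?thesis by blast
    qed
  qed
  then show ?thesis by (auto simp: fixed_points_def)
qed

end
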